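(* Let $B = B(F_n)$ be a generalized Bratteli diagram defined by a sequence of incidence matrices $(F_n)_{n\ge 0}$. Suppose that for all $w\in V_{0}$, $$\liminf_{n\to\infty}\left(\sup_{v\in V_{n}}\frac{h_{v,w}^{(n)}}{H_{v}^{(n)}}\right)=0 .$$ Then $B$ does not admit a probability tail invariant measure, i.e. there is no tail invariant Borel probability measure on the path space $X_B$. Moreover, this condition is sufficient but not necessary: there exists a generalized Bratteli diagram that admits no probability tail invariant measure and for which the displayed condition fails for some $w\in V_0$.
   Context: A generalized Bratteli diagram $B=(V,E)$ is a graded graph with vertex set $V=\bigsqcup_{n\ge 0}V_n$ and edge set $E=\bigsqcup_{n\ge 0}E_n$, where every $V_n$ is countably infinite, each edge $e\in E_n$ has a source $s(e)\in V_n$ and a range $r(e)\in V_{n+1}$ (multiple edges are allowed), $s^{-1}(v)\neq\emptyset$ for every $v\in V$, and $r^{-1}(v)$ is nonempty and finite for every $v\in V\setminus V_0$. The incidence matrices are $F_n=(f^{(n)}_{v,w})_{v\in V_{n+1},\,w\in V_n}$, where $f^{(n)}_{v,w}\in\{0,1,2,\dots\}$ is the number of edges from $w\in V_n$ to $v\in V_{n+1}$; the sequence $(F_n)$ determines $B$, written $B=B(F_n)$. The path space $X_B$ is the set of infinite edge sequences $(x_0,x_1,\dots)$ with $x_i\in E_i$ and $r(x_i)=s(x_{i+1})$ for all $i$ (so paths start in $V_0$). For a finite path $\overline e=(e_0,\dots,e_n)$ starting in $V_0$, set $s(\overline e)=s(e_0)$, $r(\overline e)=r(e_n)$, and let $[\overline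 e]=\{x\in X_B: x_i=e_i,\ 0\le i\le n\}$ be the associated cylinder set; cylinder sets form a base of clopen sets of the (Polish, zero-dimensional) topology of $X_B$. Two paths $x,y\in X_B$ are tail equivalent if $x_i=y_i$ for all sufficiently large $i$. Standing assumptions: $X_B$ has no isolated points, and the tail equivalence relation is aperiodic (all classes are infinite). A Borel measure $\mu$ on $X_B$ is tail invariant if $\mu([\overline e])=\mu([\overline e'])$ whenever $\overline e,\overline e'$ are finite paths starting at level $0$ with $r(\overline e)=r(\overline e')$. For $v\in V_n$ and $w\in V_0$, $h^{(n)}_{v,w}=(F_{n-1}\cdots F_0)_{v,w}$ is the number of finite paths from $w$ to $v$, and $H^{(n)}_v=\sum_{w\in V_0}h^{(n)}_{v,w}$ is the total (finite) number of finite paths from $V_0$ to $v$. *)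

theory Defs
  imports "HOL-Probability.Probability"
begin

text \<open>
  A graded graph: \<open>vertices B n\<close> and \<open>edges B n\<close> are the level sets, \<open>source B\<close> and \<open>range_of B\<close> the
  endpoint maps.  An edge is an element of the edge set, so parallel edges are allowed.
\<close>

record ('v, 'e) diagram =
  vertices :: "nat \<Rightarrow> 'v set"
  edges :: "nat \<Rightarrow> 'e set"
  source :: "'e \<Rightarrow> 'v"
  range_of :: "'e \<Rightarrow> 'v"

locale generalized_bratteli_diagram =
  fixes B :: "('v, 'e) diagram"
  assumes disjoint_vertices: "disjoint_family (vertices B)"
    and disjoint_edges: "disjoint_family (edges B)"
    and countable_vertices: "\<And>n. countable (vertices B n)"
    and infinite_vertices: "\<And>n. infinite (vertices B n)"
    and source_in: "\<And>n e. e \<in> edges B n \<Longrightarrow> source B e \<in> vertices B n"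
    and range_in: "\<And>n e. e \<in> edges B n \<Longrightarrow> range_of B e \<in> vertices B (Suc n)"
    and out_edges_nonempty: "\<And>n v. v \<in> vertices B n \<Longrightarrow> {e \<in> edges B n. source B e = v} \<noteq> {}"
    and in_edges_nonempty: "\<And>n v. v \<in> vertices B (Suc n) \<Longrightarrow> {e \<in> edges B n. range_of B e = v} \<noteq> {}"
    and in_edges_finite: "\<And>n v. v \<in> vertices B (Suc n) \<Longrightarrow> finite {e \<in> edges B n. range_of B e = v}"

definition incidence :: "('v, 'e) diagram \<Rightarrow> nat \<Rightarrow> 'v \<Rightarrow> 'v \<Rightarrow> nat" where
  "incidence B n v w = card {e \<in> edges B n. source B e = w \<and> range_of B e = v}"

text \<open>
  \<open>height_entry B n v w\<close> is the entry at \<open>(v, w)\<close> of the matrix product \<open>F\<^sub>n\<^sub>-\<^sub>1 \<cdots> F\<^sub>0\<close>, the empty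
  product being the identity.  The index sets are infinite, hence \<^const>\<open>infsum\<close>; in a generalized
  Bratteli diagram every vertex has finitely many incoming edges, so for \<open>v\<close> of level \<open>n\<close> all
  these sums have only finitely many nonzero terms.
\<close>

fun height_entry :: "('v, 'e) diagram \<Rightarrow> nat \<Rightarrow> 'v \<Rightarrow> 'v \<Rightarrow> nat" where
  "height_entry B 0 v w = (if v = w then 1 else 0)"
| "height_entry B (Suc n) v w = (\<Sum>\<^sub>\<infinity>u\<in>vertices B n. incidence B n v u * height_entry B n u w)"

definition total_height :: "('v, 'e) diagram \<Rightarrow> nat \<Rightarrow> 'v \<Rightarrow> nat" where
  "total_height B n v = (\<Sum>\<^sub>\<infinity>w\<in>vertices B 0. height_entry B n v w)"

definition path_space :: "('v, 'e) diagram \<Rightarrow> (nat \<Rightarrow> 'e) set" where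
  "path_space B = {x. \<forall>i. x i \<in> edges B i \<and> range_of B (x i) = source B (x (Suc i))}"

text \<open>Finite paths start at level 0 and have at least one edge.\<close>

definition finite_paths :: "('v, 'e) diagram \<Rightarrow> 'e list set" where
  "finite_paths B = {p. p \<noteq> [] \<and> (\<forall>i < length p. p ! i \<in> edges B i) \<and>
     (\<forall>i. Suc i < length p \<longrightarrow> range_of B (p ! i) = source B (p ! Suc i))}"

definition cylinder :: "('v, 'e) diagram \<Rightarrow> 'e list \<Rightarrow> (nat \<Rightarrow> 'e) set" where
  "cylinder B p = {x \<in> path_space B. \<forall>i < length p. x i = p ! i}"

definition path_topology :: "('v, 'e) diagram \<Rightarrow> (nat \<Rightarrow> 'e) topology" where
  "path_topology B = topology_generated_by (cylinder B ` finite_paths B)"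

definition path_borel :: "('v, 'e) diagram \<Rightarrow> (nat \<Rightarrow> 'e) measure" where
  "path_borel B = sigma (path_space B) {U. openin (path_topology B) U}"

definition tail_equivalent :: "(nat \<Rightarrow> 'e) \<Rightarrow> (nat \<Rightarrow> 'e) \<Rightarrow> bool" where
  "tail_equivalent x y \<longleftrightarrow> (\<forall>\<^sub>F i in sequentially. x i = y i)"

definition no_isolated_points :: "('v, 'e) diagram \<Rightarrow> bool" where
  "no_isolated_points B \<longleftrightarrow> (\<forall>x \<in> path_space B. \<not> openin (path_topology B) {x})"

definition tail_aperiodic :: "('v, 'e) diagram \<Rightarrow> bool" where
  "tail_aperiodic B \<longleftrightarrow> (\<forall>x \<in> path_space B. infinite {y \<in> path_space B. tail_equivalent x y})"

definition tail_invariant :: "('v, 'e) diagram \<Rightarrow> (nat \<Rightarrow> 'e) measure \<Rightarrow> bool" where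
  "tail_invariant B M \<longleftrightarrow> (\<forall>p \<in> finite_paths B. \<forall>q \<in> finite_paths B.
     range_of B (last p) = range_of B (last q) \<longrightarrow> emeasure M (cylinder B p) = emeasure M (cylinder B q))"

definition admits_tail_invariant_probability :: "('v, 'e) diagram \<Rightarrow> bool" where
  "admits_tail_invariant_probability B \<longleftrightarrow>
     (\<exists>M. sets M = sets (path_borel B) \<and> prob_space M \<and> tail_invariant B M)"

end

theory Submission
  imports Defs
begin

text \<open>
  A tail invariant measure \<open>\<mu>\<close> gives all cylinders ending in a vertex \<open>v\<close> of level \<open>n\<close> one common
  mass \<open>p n v\<close>, and splitting a cylinder by its next edge shows that \<open>p n u\<close> is the sum of
  \<open>p (n + 1) (r(e))\<close> over the edges \<open>e\<close> leaving \<open>u\<close>.  Only this family of weights matters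
  (\<open>exists_invariant_weight\<close>).  Counting paths through level \<open>n\<close>, the set of paths that start in \<open>w\<close>
  has mass \<open>\<Sum>\<^sub>v h\<^sub>v\<^sub>w p n v\<close>, while the total mass is \<open>\<Sum>\<^sub>v H\<^sub>v p n v = 1\<close>.  So the first
  number is at most \<open>sup\<^sub>v h\<^sub>v\<^sub>w / H\<^sub>v\<close> for every \<open>n\<close> (\<open>weight_le_height_ratio\<close>).  If the lower limit of
  these suprema is \<open>0\<close> for each \<open>w\<close>, then every one of the countably many starting vertices
  carries mass \<open>0\<close>, which is impossible for a probability measure.

  The condition fails to be necessary because it only sees where paths start in \<open>V\<^sub>0\<close>: one
  vertex of \<open>V\<^sub>0\<close> with edges to all of \<open>V\<^sub>1\<close> can account for half of the paths into every later
  vertex, even if the diagram from level 1 on leaves no room for a finite invariant measure.  In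
  the example every level is a copy of \<open>\<nat>\<close>.  Between levels \<open>n\<close> and \<open>n + 1\<close>, with \<open>n \<ge> 1\<close>, the
  vertex \<open>k\<close> is joined to \<open>k\<close> and to the number obtained by flipping the binary digit \<open>n\<close> of \<open>k\<close>.
  Thus \<open>k\<close> and its flip have the same successors, hence equal weights, and this symmetry is
  inherited by all levels from 1 to \<open>n\<close> (\<open>weight_flip_bit\<close>).  At level 1 each vertex therefore has
  the same weight as infinitely many others, so a finite total forces all these weights to vanish.
\<close>

section \<open>Finite and infinite paths\<close>

context generalized_bratteli_diagram
begin

lemma finite_path_snoc:
  assumes "p \<in> finite_paths B" "e \<in> edges B (length p)" "source B e = range_of B (last p)"
  shows "p @ [e] \<in> finite_paths B"
  using assms unfolding finite_paths_def
  by (auto simp: nth_append less_Suc_eq last_conv_nth)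
     (metis One_nat_def diff_Suc_1)

lemma finite_path_ending_in_edge:
  "e \<in> edges B n \<Longrightarrow> \<exists>p\<in>finite_paths B. length p = Suc n \<and> last p = e"
proof (induction n arbitrary: e)
  case 0
  then have "[e] \<in> finite_paths B" by (simp add: finite_paths_def)
  then show ?case by force
next
  case (Suc n)
  from source_in[OF Suc.prems] in_edges_nonempty
  obtain e' where e': "e' \<in> edges B n" "range_of B e' = source B e" by blast
  from Suc.IH[OF e'(1)] obtain p where p: "p \<in> finite_paths B" "length p = Suc n" "last p = e'"
    by blast
  then have "p @ [e] \<in> finite_paths B" using finite_path_snoc Suc.prems e'(2) by simp
  then show ?case using p(2) by (intro bexI[of _ "p @ [e]"]) auto
qed

lemma finite_path_to_vertex:
  assumes "v \<in> vertices B (Suc n)"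
  shows "\<exists>p\<in>finite_paths B. length p = Suc n \<and> range_of B (last p) = v"
  using in_edges_nonempty[OF assms] finite_path_ending_in_edge by blast

lemma infinite_path_from_edge:
  assumes "e \<in> edges B n"
  shows "\<exists>z. z 0 = e \<and> (\<forall>i. z i \<in> edges B (n + i) \<and> range_of B (z i) = source B (z (Suc i)))"
proof -
  have step: "\<exists>e'. e' \<in> edges B (n + Suc i) \<and> range_of B e = source B e'"
    if "e \<in> edges B (n + i)" for e i
    using out_edges_nonempty[of "range_of B e" "n + Suc i"] range_in[OF that] by force
  have "\<exists>z. \<forall>i. (z i \<in> edges B (n + i) \<and> (i = 0 \<longrightarrow> z i = e)) \<and>
      range_of B (z i) = source B (z (Suc i))"
    by (rule dependent_nat_choice) (use assms step in auto)
  then show ?thesis by blast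
qed

lemma splice_path:
  assumes "p \<in> finite_paths B" "x \<in> path_space B" "range_of B (last p) = source B (x (length p))"
  shows "(\<lambda>i. if i < length p then p ! i else x i) \<in> path_space B"
proof -
  have "p \<noteq> []" using assms(1) by (simp add: finite_paths_def)
  moreover have "range_of B (p ! i) = source B (x (Suc i))"
    if "i < length p" "\<not> Suc i < length p" for i
  proof -
    from that have "Suc i = length p" by simp
    with \<open>p \<noteq> []\<close> show ?thesis using assms(3) by (metis last_conv_nth diff_Suc_1)
  qed
  ultimately show ?thesis using assms(1,2) by (auto simp: path_space_def finite_paths_def)
qed

lemma open_contains_agreeing_paths:
  assumes "openin (path_topology B) U" "x \<in> U"
  shows "\<exists>N. \<forall>y\<in>path_space B. (\<forall>i<N. y i = x i) \<longrightarrow> y \<in> U"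
proof -
  have "generate_topology_on (cylinder B ` finite_paths B) U"
    using assms(1) unfolding path_topology_def by (rule openin_topology_generated_by)
  then show ?thesis using assms(2)
  proof (induction arbitrary: x)
    case Empty
    then show ?case by simp
  next
    case (Int a b)
    then have "x \<in> a" "x \<in> b" by auto
    from Int.IH(1)[OF \<open>x \<in> a\<close>]
    obtain N where N: "\<forall>y\<in>path_space B. (\<forall>i<N. y i = x i) \<longrightarrow> y \<in> a" ..
    from Int.IH(2)[OF \<open>x \<in> b\<close>]
    obtain M where M: "\<forall>y\<in>path_space B. (\<forall>i<M. y i = x i) \<longrightarrow> y \<in> b" ..
    show ?case by (rule exI[of _ "max N M"]) (use N M in simp)
  next
    case (UN K)
    then obtain k where k: "k \<in> K" "x \<in> k" by blast
    from UN.IH[OF k] obtain N where "\<forall>y\<in>path_space B. (\<forall>i<N. y i = x i) \<longrightarrow> y \<in> k" ..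
    with k(1) show ?case by (intro exI[of _ N]) blast
  next
    case (Basis s)
    then obtain p where "s = cylinder B p" by blast
    then show ?case using Basis.prems by (intro exI[of _ "length p"]) (auto simp: cylinder_def)
  qed
qed

text \<open>
  A neighbourhood of \<open>x\<close> restricts only finitely many edges, so one may leave \<open>x\<close> at a later level
  through a second edge with the same source and continue arbitrarily.  Branching is asked for from
  level 1 on only, since in the example below level 0 has vertices with a single outgoing edge.
\<close>

lemma no_isolated_pointsI:
  assumes "\<And>n e. n \<ge> 1 \<Longrightarrow> e \<in> edges B n \<Longrightarrow> \<exists>e'\<in>edges B n. e' \<noteq> e \<and> source B e' = source B e"
  shows "no_isolated_points B"
  unfolding no_isolated_points_def
proof (intro ballI notI)
  fix x assume x: "x \<in> path_space B" and "openin (path_topology B) {x}"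
  then obtain N where N: "\<And>y. y\<in>path_space B \<Longrightarrow> (\<forall>i<N. y i = x i) \<Longrightarrow> y = x"
    using open_contains_agreeing_paths[of "{x}" x] by blast
  have xe: "x i \<in> edges B i" "range_of B (x i) = source B (x (Suc i))" for i
    using x by (auto simp: path_space_def)
  obtain e where e: "e \<in> edges B (Suc N)" "e \<noteq> x (Suc N)" "source B e = source B (x (Suc N))"
    using assms[OF _ xe(1)[of "Suc N"]] by auto
  obtain z where z: "z 0 = e" "\<And>i. z i \<in> edges B (Suc N + i)"
      "\<And>i. range_of B (z i) = source B (z (Suc i))"
    using infinite_path_from_edge[OF e(1)] by blast
  define y where "y i = (if i < Suc N then x i else z (i - Suc N))" for i
  have "y \<in> path_space B"
    unfolding path_space_def
  proof (intro CollectI allI conjI)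
    fix i
    show "y i \<in> edges B i" using xe(1) z(2)[of "i - Suc N"] by (auto simp: y_def)
    consider "i < N" | "i = N" | "i \<ge> Suc N" by linarith
    then show "range_of B (y i) = source B (y (Suc i))"
      using xe(2) z(1) z(3)[of "i - Suc N"] e(3)
      by cases (auto simp: y_def Suc_diff_le Suc_diff_Suc)
  qed
  then have "y = x" using N by (simp add: y_def)
  then have "y (Suc N) = x (Suc N)" by simp
  then show False using z(1) e(2) by (simp add: y_def)
qed

text \<open>
  For each level \<open>n\<close>, replace the edge of \<open>x\<close> at that level by another one with the same range and
  lead back to level 0 from there.  The resulting paths are tail equivalent to \<open>x\<close>, and they are
  pairwise distinct because the last level at which they differ from \<open>x\<close> is \<open>n\<close>.
\<close>

lemma tail_aperiodicI:
  assumes "\<And>n e. e \<in> edges B n \<Longrightarrow> \<exists>e'\<in>edges B n. e' \<noteq> e \<and> range_of B e' = range_of B e"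
  shows "tail_aperiodic B"
  unfolding tail_aperiodic_def
proof
  fix x assume x: "x \<in> path_space B"
  have xe: "x i \<in> edges B i" "range_of B (x i) = source B (x (Suc i))" for i
    using x by (auto simp: path_space_def)
  have "\<exists>y\<in>path_space B. y n \<noteq> x n \<and> (\<forall>i>n. y i = x i)" for n
  proof -
    obtain e where e: "e \<in> edges B n" "e \<noteq> x n" "range_of B e = range_of B (x n)"
      using assms[OF xe(1)[of n]] by auto
    obtain p where p: "p \<in> finite_paths B" "length p = Suc n" "last p = e"
      using finite_path_ending_in_edge[OF e(1)] by blast
    let ?y = "\<lambda>i. if i < length p then p ! i else x i"
    have "?y \<in> path_space B" by (rule splice_path) (use p e x xe in auto)
    moreover have "p ! n = e" using p by (metis diff_Suc_1 last_conv_nth length_0_conv nat.distinct(1))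
    ultimately show ?thesis using p(2) e(2) by (intro bexI[of _ ?y]) auto
  qed
  then obtain y where y: "\<And>n. y n \<in> path_space B" "\<And>n. y n n \<noteq> x n" "\<And>n i. i > n \<Longrightarrow> y n i = x i"
    by metis
  have "inj y"
  proof (rule linorder_injI)
    fix m n :: nat assume "m < n"
    then show "y m \<noteq> y n" using y(2)[of n] y(3)[of m n] by auto
  qed
  moreover have "range y \<subseteq> {y \<in> path_space B. tail_equivalent x y}"
  proof (clarify, intro conjI)
    fix n
    have "\<forall>\<^sub>F i in sequentially. x i = y n i"
      using eventually_gt_at_top[of n] by eventually_elim (simp add: y(3))
    then show "tail_equivalent x (y n)" by (simp add: tail_equivalent_def)
  qed (rule y(1))
  ultimately show "infinite {y \<in> path_space B. tail_equivalent x y}"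
    using infinite_super range_inj_infinite by blast
qed

section \<open>Path counts\<close>

text \<open>
  Only finitely many edges enter a vertex, so the infinite matrix product collapses to a finite sum
  over them.  The same recursion holds for the total heights, and
  \<open>invariant_weight_transport\<close> below applies to every family of numbers that satisfies it.
\<close>

lemma height_entry_Suc:
  assumes v: "v \<in> vertices B (Suc n)"
  shows "height_entry B (Suc n) v w =
    (\<Sum>e\<in>{e\<in>edges B n. range_of B e = v}. height_entry B n (source B e) w)"
proof -
  let ?I = "{e\<in>edges B n. range_of B e = v}"
  have fin: "finite ?I" by (rule in_edges_finite[OF v])
  have inc: "incidence B n v u = card {e\<in>?I. source B e = u}" for u
    unfolding incidence_def by (rule arg_cong[where f = card]) auto
  have "height_entry B (Suc n) v w =
      (\<Sum>\<^sub>\<infinity>u\<in>source B ` ?I. incidence B n v u * height_entry B n u w)"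
    unfolding height_entry.simps
  proof (rule infsum_cong_neutral)
    fix u assume "u \<in> vertices B n - source B ` ?I"
    then have "{e\<in>?I. source B e = u} = {}" by blast
    then show "incidence B n v u * height_entry B n u w = 0" unfolding inc by (metis card.empty mult_0)
  qed (use source_in in auto)
  also have "\<dots> = (\<Sum>u\<in>source B ` ?I. \<Sum>e\<in>{e\<in>?I. source B e = u}. height_entry B n (source B e) w)"
    using fin by (simp add: inc)
  also have "\<dots> = (\<Sum>e\<in>?I. height_entry B n (source B e) w)"
    by (rule sum.image_gen[OF fin, symmetric])
  finally show ?thesis .
qed

lemma finite_height_support:
  "v \<in> vertices B n \<Longrightarrow> finite {w. height_entry B n v w \<noteq> 0}"
proof (induction n arbitrary: v)
  case 0
  show ?case by (rule finite_subset[of _ "{v}"]) auto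
next
  case (Suc n)
  let ?I = "{e\<in>edges B n. range_of B e = v}"
  have "{w. height_entry B (Suc n) v w \<noteq> 0} \<subseteq> (\<Union>e\<in>?I. {w. height_entry B n (source B e) w \<noteq> 0})"
  proof
    fix w assume "w \<in> {w. height_entry B (Suc n) v w \<noteq> 0}"
    then have "(\<Sum>e\<in>?I. height_entry B n (source B e) w) \<noteq> 0"
      using height_entry_Suc[OF Suc.prems] by simp
    then obtain e where "e \<in> ?I" "height_entry B n (source B e) w \<noteq> 0"
      by (rule sum.not_neutral_contains_not_neutral)
    then show "w \<in> (\<Union>e\<in>?I. {w. height_entry B n (source B e) w \<noteq> 0})" by blast
  qed
  moreover have "finite \<dots>"
    using Suc.IH in_edges_finite[OF Suc.prems] source_in by blast
  ultimately show ?case by (rule finite_subset)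
qed

lemma total_height_eq_sum:
  assumes "finite W" "W \<subseteq> vertices B 0" "{w\<in>vertices B 0. height_entry B n v w \<noteq> 0} \<subseteq> W"
  shows "total_height B n v = (\<Sum>w\<in>W. height_entry B n v w)"
proof -
  have "total_height B n v = infsum (height_entry B n v) W"
    unfolding total_height_def by (rule infsum_cong_neutral) (use assms in auto)
  then show ?thesis using assms(1) by simp
qed

lemma total_height_0: "v \<in> vertices B 0 \<Longrightarrow> total_height B 0 v = 1"
  by (subst total_height_eq_sum[of "{v}"]) auto

lemma total_height_Suc:
  assumes v: "v \<in> vertices B (Suc n)"
  shows "total_height B (Suc n) v =
    (\<Sum>e\<in>{e\<in>edges B n. range_of B e = v}. total_height B n (source B e))"
proof -
  let ?I = "{e\<in>edges B n. range_of B e = v}"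
  \<comment> \<open>one finite set of starting vertices that serves \<open>v\<close> and all its predecessors, so that the
    two summations can be interchanged\<close>
  define W where "W = vertices B 0 \<inter> ({w. height_entry B (Suc n) v w \<noteq> 0} \<union>
      (\<Union>e\<in>?I. {w. height_entry B n (source B e) w \<noteq> 0}))"
  have W: "finite W" "W \<subseteq> vertices B 0"
    unfolding W_def
    using finite_height_support[OF v] finite_height_support[OF source_in] in_edges_finite[OF v]
    by auto
  have "total_height B (Suc n) v = (\<Sum>w\<in>W. height_entry B (Suc n) v w)"
    by (rule total_height_eq_sum[OF W]) (auto simp: W_def)
  also have "\<dots> = (\<Sum>e\<in>?I. \<Sum>w\<in>W. height_entry B n (source B e) w)"
    unfolding height_entry_Suc[OF v] by (rule sum.swap)
  also have "\<dots> = (\<Sum>e\<in>?I. total_height B n (source B e))"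
    by (intro sum.cong refl total_height_eq_sum[OF W, symmetric]) (auto simp: W_def)
  finally show ?thesis .
qed

lemma total_height_pos: "v \<in> vertices B n \<Longrightarrow> total_height B n v > 0"
proof (induction n arbitrary: v)
  case 0
  then show ?case by (simp add: total_height_0)
next
  case (Suc n)
  then show ?case
    unfolding total_height_Suc[OF Suc.prems]
    using in_edges_nonempty[OF Suc.prems] in_edges_finite[OF Suc.prems] source_in
    by (intro sum_pos) auto
qed

end

section \<open>Invariant weights\<close>

lemma nn_integral_count_space_fibres:
  fixes f :: "'e \<Rightarrow> ennreal"
  assumes "\<And>e. e \<in> E \<Longrightarrow> s e \<in> V"
  shows "(\<integral>\<^sup>+e. f e \<partial>count_space E) =
    (\<integral>\<^sup>+v. (\<integral>\<^sup>+e. f e \<partial>count_space {e\<in>E. s e = v}) \<partial>count_space V)"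
proof -
  let ?g = "\<lambda>(v, e). f e * indicator {e\<in>E. s e = v} e"
  have "(\<integral>\<^sup>+e. f e \<partial>count_space E) = (\<integral>\<^sup>+e. f e * indicator E e \<partial>count_space UNIV)"
    by (simp add: nn_integral_count_space_indicator)
  also have "\<dots> = (\<integral>\<^sup>+e. (\<integral>\<^sup>+v. ?g (v, e) \<partial>count_space UNIV) \<partial>count_space UNIV)"
  proof (rule nn_integral_cong)
    fix e
    have "(\<integral>\<^sup>+v. ?g (v, e) \<partial>count_space UNIV) =
        (\<integral>\<^sup>+v. f e * indicator E e * indicator {s e} v \<partial>count_space UNIV)"
      by (rule nn_integral_cong) (auto split: split_indicator)
    then show "f e * indicator E e = (\<integral>\<^sup>+v. ?g (v, e) \<partial>count_space UNIV)"
      by simp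
  qed
  also have "\<dots> = (\<integral>\<^sup>+v. (\<integral>\<^sup>+e. ?g (v, e) \<partial>count_space UNIV) \<partial>count_space UNIV)"
    by (simp only: nn_integral_fst_count_space nn_integral_snd_count_space)
  also have "\<dots> = (\<integral>\<^sup>+v. (\<integral>\<^sup>+e. f e \<partial>count_space {e\<in>E. s e = v}) * indicator V v \<partial>count_space UNIV)"
  proof (rule nn_integral_cong)
    fix v
    have "{e\<in>E. s e = v} = {}" if "v \<notin> V" using assms that by blast
    then show "(\<integral>\<^sup>+e. ?g (v, e) \<partial>count_space UNIV) =
        (\<integral>\<^sup>+e. f e \<partial>count_space {e\<in>E. s e = v}) * indicator V v"
      by (auto simp: nn_integral_count_space_indicator split: split_indicator)
  qed
  also have "\<dots> = (\<integral>\<^sup>+v. (\<integral>\<^sup>+e. f e \<partial>count_space {e\<in>E. s e = v}) \<partial>count_space V)"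
    by (simp add: nn_integral_count_space_indicator)
  finally show ?thesis .
qed

text \<open>
  The weight of a vertex of level \<open>n > 0\<close> stands for the common measure of the cylinders ending there,
  that of a vertex of level 0 for the measure of the set of paths starting there.  Infinitely many
  edges may leave a vertex, so the sums are integrals with respect to counting measure, with values
  in \<^typ>\<open>ennreal\<close>.
\<close>

definition invariant_weight :: "('v, 'e) diagram \<Rightarrow> (nat \<Rightarrow> 'v \<Rightarrow> ennreal) \<Rightarrow> bool" where
  "invariant_weight B p \<longleftrightarrow>
    (\<forall>n. \<forall>u\<in>vertices B n.
       p n u = (\<integral>\<^sup>+e. p (Suc n) (range_of B e) \<partial>count_space {e\<in>edges B n. source B e = u})) \<and>
    (\<integral>\<^sup>+w. p 0 w \<partial>count_space (vertices B 0)) = 1"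

context generalized_bratteli_diagram
begin

lemma countable_edges: "countable (edges B n)"
proof -
  have "edges B n = (\<Union>v\<in>vertices B (Suc n). {e\<in>edges B n. range_of B e = v})"
    using range_in by blast
  then show ?thesis
    using countable_UN[OF countable_vertices, of "Suc n" "\<lambda>v. {e\<in>edges B n. range_of B e = v}"]
      in_edges_finite by (simp add: countable_finite)
qed

lemma open_subset_path_space: "openin (path_topology B) U \<Longrightarrow> U \<subseteq> path_space B"
  using openin_subset[of "path_topology B" U]
  by (auto simp: path_topology_def topology_generated_by_topspace cylinder_def)

lemma space_path_borel: "space (path_borel B) = path_space B"
  unfolding path_borel_def by (rule space_measure_of) (use open_subset_path_space in blast)

lemma cylinder_in_path_borel:
  assumes "p \<in> finite_paths B"
  shows "cylinder B p \<in> sets (path_borel B)"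
proof -
  have "openin (path_topology B) (cylinder B p)"
    unfolding path_topology_def by (rule topology_generated_by_Basis) (use assms in blast)
  moreover have "{U. openin (path_topology B) U} \<subseteq> Pow (path_space B)"
    using open_subset_path_space by blast
  ultimately show ?thesis
    unfolding path_borel_def by (simp add: sets_measure_of)
qed

text \<open>
  Extending a path by its next edge partitions the cylinder into countably many cylinders, so the
  additivity of the measure becomes the defining recursion of the weights.
\<close>

lemma exists_invariant_weight:
  assumes "admits_tail_invariant_probability B"
  shows "\<exists>p. invariant_weight B p"
proof -
  from assms obtain M where sets_M: "sets M = sets (path_borel B)" and "prob_space M"
    and inv: "tail_invariant B M"
    unfolding admits_tail_invariant_probability_def by blast
  interpret prob_space M by fact
  have space_M: "space M = path_space B"
    using sets_eq_imp_space_eq[OF sets_M] space_path_borel by simp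
  have cyl: "cylinder B q \<in> sets M" if "q \<in> finite_paths B" for q
    using cylinder_in_path_borel[OF that] sets_M by simp
  define start where "start w = {x\<in>path_space B. source B (x 0) = w}" for w
  \<comment> \<open>by tail invariance the choice of the path ending in \<open>v\<close> does not affect its measure\<close>
  define p where "p n v = (if n = 0 then emeasure M (start v)
     else emeasure M (cylinder B (SOME q. q \<in> finite_paths B \<and> range_of B (last q) = v)))" for n :: nat and v
  have p_cyl: "p (Suc n) (range_of B (last q)) = emeasure M (cylinder B q)"
    if "q \<in> finite_paths B" for q n
  proof -
    let ?P = "\<lambda>q'. q' \<in> finite_paths B \<and> range_of B (last q') = range_of B (last q)"
    have "?P (SOME q'. ?P q')" by (rule someI[of ?P q]) (use that in simp)
    then have "emeasure M (cylinder B (SOME q'. ?P q')) = emeasure M (cylinder B q)"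
      using inv that unfolding tail_invariant_def by blast
    then show ?thesis by (simp add: p_def)
  qed
  \<comment> \<open>with \<open>q = []\<close> this also covers the paths starting in a given vertex, which do not form
    the cylinder of a finite path\<close>
  have split: "emeasure M (\<Union>e\<in>I. cylinder B (q @ [e])) =
      (\<integral>\<^sup>+e. p (Suc n) (range_of B e) \<partial>count_space I)"
    if "I \<subseteq> edges B (length q)" "\<And>e. e \<in> I \<Longrightarrow> q @ [e] \<in> finite_paths B" for q I n
  proof -
    have "disjoint_family_on (\<lambda>e. cylinder B (q @ [e])) I"
      by (auto simp: disjoint_family_on_def cylinder_def all_conj_distrib nth_append less_Suc_eq)
    moreover have "countable I" using that(1) countable_edges countable_subset by blast
    ultimately have "emeasure M (\<Union>e\<in>I. cylinder B (q @ [e])) =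
        (\<integral>\<^sup>+e. emeasure M (cylinder B (q @ [e])) \<partial>count_space I)"
      using that(2) cyl by (intro emeasure_UN_countable) auto
    also have "\<dots> = (\<integral>\<^sup>+e. p (Suc n) (range_of B e) \<partial>count_space I)"
      using p_cyl[OF that(2), of _ n] by (intro nn_integral_cong) simp
    finally show ?thesis .
  qed
  have single: "[] @ [e] \<in> finite_paths B" if "e \<in> edges B 0" for e
    using that by (simp add: finite_paths_def)
  have start_eq: "start w = (\<Union>e\<in>{e\<in>edges B 0. source B e = w}. cylinder B ([] @ [e]))" for w
    by (auto simp: start_def cylinder_def path_space_def)
  have start_meas: "start w \<in> sets M" for w
    unfolding start_eq
    by (rule sets.countable_UN'') (use countable_edges cyl single in \<open>auto intro: countable_subset[OF _ countable_edges[of 0]]\<close>)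
  have "p n u = (\<integral>\<^sup>+e. p (Suc n) (range_of B e) \<partial>count_space {e\<in>edges B n. source B e = u})"
    if u: "u \<in> vertices B n" for n u
  proof (cases n)
    case 0
    then have "p n u = emeasure M (start u)" by (simp add: p_def)
    also have "\<dots> = (\<integral>\<^sup>+e. p (Suc n) (range_of B e) \<partial>count_space {e\<in>edges B n. source B e = u})"
      unfolding start_eq 0 by (rule split) (use single in auto)
    finally show ?thesis .
  next
    case (Suc m)
    then obtain q where q: "q \<in> finite_paths B" "length q = n" "range_of B (last q) = u"
      using finite_path_to_vertex u by blast
    let ?I = "{e\<in>edges B n. source B e = u}"
    have "q \<noteq> []" using q(1) by (simp add: finite_paths_def)
    have "x n \<in> ?I" if "x \<in> cylinder B q" for x
    proof -
      have "x m = last q"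
        using that q(2) Suc last_conv_nth[OF \<open>q \<noteq> []\<close>] by (simp add: cylinder_def)
      moreover have "x n \<in> edges B n" "range_of B (x m) = source B (x n)"
        using that Suc by (auto simp: cylinder_def path_space_def)
      ultimately show ?thesis using q(3) by simp
    qed
    then have "cylinder B q = (\<Union>e\<in>?I. cylinder B (q @ [e]))"
      using q(2) by (auto simp: cylinder_def nth_append less_Suc_eq)
    then have "p n u = emeasure M (\<Union>e\<in>?I. cylinder B (q @ [e]))"
      using p_cyl[OF q(1), of m] q(3) Suc by simp
    also have "\<dots> = (\<integral>\<^sup>+e. p (Suc n) (range_of B e) \<partial>count_space ?I)"
      by (rule split) (use q finite_path_snoc in auto)
    finally show ?thesis .
  qed
  moreover have "(\<integral>\<^sup>+w. p 0 w \<partial>count_space (vertices B 0)) = 1"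
  proof -
    have "path_space B = (\<Union>w\<in>vertices B 0. start w)"
      using source_in by (force simp: start_def path_space_def)
    then have "1 = emeasure M (\<Union>w\<in>vertices B 0. start w)"
      using emeasure_space_1 space_M by simp
    also have "\<dots> = (\<integral>\<^sup>+w. emeasure M (start w) \<partial>count_space (vertices B 0))"
      by (rule emeasure_UN_countable)
        (use start_meas countable_vertices in \<open>auto simp: disjoint_family_on_def start_def\<close>)
    finally show ?thesis by (simp add: p_def)
  qed
  ultimately show ?thesis unfolding invariant_weight_def by blast
qed

text \<open>
  If \<open>g\<close> is carried forward by the incidence matrices, then pairing it with \<open>p\<close>, which is carried
  backward by their transposes, gives the same value at every level: both
  \<open>\<Sum>\<^sub>u g n u * p n u\<close> and \<open>\<Sum>\<^sub>v g (n + 1) v * p (n + 1) v\<close> are the sum over the edges \<open>e\<close> of level \<open>n\<close>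
  of \<open>g n (s(e)) * p (n + 1) (r(e))\<close>, grouped by sources and by ranges.
\<close>

lemma invariant_weight_transport:
  fixes g :: "nat \<Rightarrow> 'v \<Rightarrow> nat"
  assumes p: "invariant_weight B p"
    and g: "\<And>n v. v \<in> vertices B (Suc n) \<Longrightarrow>
      g (Suc n) v = (\<Sum>e\<in>{e\<in>edges B n. range_of B e = v}. g n (source B e))"
  shows "(\<integral>\<^sup>+v. of_nat (g n v) * p n v \<partial>count_space (vertices B n)) =
    (\<integral>\<^sup>+w. of_nat (g 0 w) * p 0 w \<partial>count_space (vertices B 0))"
proof (induction n)
  case (Suc n)
  let ?f = "\<lambda>e. of_nat (g n (source B e)) * p (Suc n) (range_of B e)"
  have "(\<integral>\<^sup>+u. of_nat (g n u) * p n u \<partial>count_space (vertices B n)) =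
      (\<integral>\<^sup>+u. (\<integral>\<^sup>+e. ?f e \<partial>count_space {e\<in>edges B n. source B e = u}) \<partial>count_space (vertices B n))"
  proof (rule nn_integral_cong)
    fix u assume "u \<in> space (count_space (vertices B n))"
    then have "p n u = (\<integral>\<^sup>+e. p (Suc n) (range_of B e) \<partial>count_space {e\<in>edges B n. source B e = u})"
      using p by (simp add: invariant_weight_def)
    then have "of_nat (g n u) * p n u =
        (\<integral>\<^sup>+e. of_nat (g n u) * p (Suc n) (range_of B e) \<partial>count_space {e\<in>edges B n. source B e = u})"
      by (simp add: nn_integral_cmult)
    also have "\<dots> = (\<integral>\<^sup>+e. ?f e \<partial>count_space {e\<in>edges B n. source B e = u})"
      by (rule nn_integral_cong) simp
    finally show "of_nat (g n u) * p n u = \<dots>" .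
  qed
  also have "\<dots> = (\<integral>\<^sup>+e. ?f e \<partial>count_space (edges B n))"
    by (rule nn_integral_count_space_fibres[symmetric]) (rule source_in)
  also have "\<dots> = (\<integral>\<^sup>+v. (\<integral>\<^sup>+e. ?f e \<partial>count_space {e\<in>edges B n. range_of B e = v})
      \<partial>count_space (vertices B (Suc n)))"
    by (rule nn_integral_count_space_fibres) (rule range_in)
  also have "\<dots> = (\<integral>\<^sup>+v. of_nat (g (Suc n) v) * p (Suc n) v \<partial>count_space (vertices B (Suc n)))"
    by (rule nn_integral_cong)
      (simp add: nn_integral_count_space_finite in_edges_finite g sum_distrib_right)
  finally show ?case using Suc.IH by simp
qed simp

lemma total_weight:
  assumes "invariant_weight B p"
  shows "(\<integral>\<^sup>+v. of_nat (total_height B n v) * p n v \<partial>count_space (vertices B n)) = 1"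
proof -
  have "(\<integral>\<^sup>+v. of_nat (total_height B n v) * p n v \<partial>count_space (vertices B n)) =
      (\<integral>\<^sup>+w. of_nat (total_height B 0 w) * p 0 w \<partial>count_space (vertices B 0))"
    by (rule invariant_weight_transport[OF assms total_height_Suc])
  also have "\<dots> = (\<integral>\<^sup>+w. p 0 w \<partial>count_space (vertices B 0))"
    by (rule nn_integral_cong) (simp add: total_height_0)
  finally show ?thesis using assms by (simp add: invariant_weight_def)
qed

lemma weight_eq_heights:
  assumes "invariant_weight B p" "w \<in> vertices B 0"
  shows "p 0 w = (\<integral>\<^sup>+v. of_nat (height_entry B n v w) * p n v \<partial>count_space (vertices B n))"
proof -
  have "(\<integral>\<^sup>+v. of_nat (height_entry B n v w) * p n v \<partial>count_space (vertices B n)) =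
      (\<integral>\<^sup>+u. of_nat (height_entry B 0 u w) * p 0 u \<partial>count_space (vertices B 0))"
    by (rule invariant_weight_transport[OF assms(1), of "\<lambda>n v. height_entry B n v w", OF height_entry_Suc])
  also have "\<dots> = (\<Sum>u\<in>{w}. of_nat (height_entry B 0 u w) * p 0 u)"
    by (rule nn_integral_count_space') (use assms(2) in auto)
  finally show ?thesis by simp
qed

text \<open>
  The mass of the paths starting in \<open>w\<close> is an average of the ratios \<open>h\<^sub>v\<^sub>w / H\<^sub>v\<close> over the vertices of
  level \<open>n\<close>, with averaging weights \<open>H\<^sub>v p n v\<close> of sum \<open>1\<close>.
\<close>

lemma weight_le_height_ratio:
  assumes p: "invariant_weight B p" and w: "w \<in> vertices B 0"
    and c: "(SUP v\<in>vertices B n. ereal (real (height_entry B n v w) / real (total_height B n v))) \<le> ereal c"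
  shows "p 0 w \<le> ennreal c"
proof -
  have h_le: "of_nat (height_entry B n v w) \<le> ennreal c * of_nat (total_height B n v)"
    if v: "v \<in> vertices B n" for v
  proof -
    have "ereal (real (height_entry B n v w) / real (total_height B n v)) \<le> ereal c"
      using c v by (simp add: SUP_le_iff)
    then have "real (height_entry B n v w) \<le> c * real (total_height B n v)"
      using total_height_pos[OF v] by (simp add: pos_divide_le_eq)
    then have "ennreal (real (height_entry B n v w)) \<le> ennreal (c * real (total_height B n v))"
      by (rule ennreal_leI)
    then show ?thesis by (simp add: ennreal_mult'' ennreal_of_nat_eq_real_of_nat)
  qed
  have "p 0 w = (\<integral>\<^sup>+v. of_nat (height_entry B n v w) * p n v \<partial>count_space (vertices B n))"
    by (rule weight_eq_heights[OF p w])
  also have "\<dots> \<le> (\<integral>\<^sup>+v. ennreal c * (of_nat (total_height B n v) * p n v) \<partial>count_space (vertices B n))"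
    using h_le by (intro nn_integral_mono) (simp add: mult_right_mono flip: mult.assoc)
  also have "\<dots> = ennreal c"
    using total_weight[OF p, of n] by (simp add: nn_integral_cmult)
  finally show ?thesis .
qed

theorem no_tail_invariant_probability:
  assumes lim: "\<And>w. w \<in> vertices B 0 \<Longrightarrow>
    liminf (\<lambda>n. SUP v\<in>vertices B n. ereal (real (height_entry B n v w) / real (total_height B n v))) = 0"
  shows "\<not> admits_tail_invariant_probability B"
proof
  assume "admits_tail_invariant_probability B"
  then obtain p where p: "invariant_weight B p" using exists_invariant_weight by blast
  have "p 0 w = 0" if w: "w \<in> vertices B 0" for w
  proof -
    have "p 0 w \<le> 0 + ennreal c" if "c > 0" for c
    proof -
      let ?S = "\<lambda>n. SUP v\<in>vertices B n. ereal (real (height_entry B n v w) / real (total_height B n v))"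
      have "\<not> (\<forall>\<^sub>F n in sequentially. ereal c \<le> ?S n)"
        using Liminf_bounded[of "ereal c" ?S sequentially] lim[OF w] that by auto
      then obtain n where "?S n < ereal c"
        by (metis (mono_tags, lifting) always_eventually linorder_not_le)
      from weight_le_height_ratio[OF p w less_imp_le[OF this]] show ?thesis by simp
    qed
    then have "p 0 w \<le> 0" by (rule ennreal_le_epsilon)
    then show ?thesis by simp
  qed
  then have "(\<integral>\<^sup>+w. p 0 w \<partial>count_space (vertices B 0)) = (\<integral>\<^sup>+w. 0 \<partial>count_space (vertices B 0))"
    by (intro nn_integral_cong) simp
  then show False using p by (simp add: invariant_weight_def)
qed

end

section \<open>A diagram violating the liminf condition\<close>

text \<open>
  The vertex \<open>k\<close> of level \<open>n\<close> and the edges are tuples coded as natural numbers; carrying the level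
  in the code makes the levels disjoint.
\<close>

definition flip_vertex :: "nat \<Rightarrow> nat \<Rightarrow> nat" where
  "flip_vertex n k = to_nat (n, k)"

definition flip_edge :: "nat \<Rightarrow> nat \<Rightarrow> bool \<Rightarrow> nat" where
  "flip_edge n k b = to_nat (n, k, b)"

text \<open>
  Two edges, told apart by \<open>b\<close>, enter each vertex \<open>k\<close> of level \<open>n + 1\<close>.  One comes from \<open>k\<close>; the
  other comes from \<open>0\<close> if \<open>n = 0\<close>, which makes half of all paths start in \<open>0\<close>, and from the number
  with binary digit \<open>n\<close> flipped otherwise.
\<close>

definition flip_source :: "nat \<Rightarrow> nat \<Rightarrow> bool \<Rightarrow> nat" where
  "flip_source n k b = (if b then k else if n = 0 then 0 else flip_bit n k)"

definition flip_diagram :: "(nat, nat) diagram" where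
  "flip_diagram =
    \<lparr>vertices = (\<lambda>n. range (flip_vertex n)),
     edges = (\<lambda>n. range (case_prod (flip_edge n))),
     source = (\<lambda>e. case from_nat e of (n, k, b) \<Rightarrow> flip_vertex n (flip_source n k b)),
     range_of = (\<lambda>e. case from_nat e of (n, k, b :: bool) \<Rightarrow> flip_vertex (Suc n) k)\<rparr>"

lemma flip_vertex_eq_iff [simp]: "flip_vertex n k = flip_vertex m j \<longleftrightarrow> n = m \<and> k = j"
  by (simp add: flip_vertex_def)

lemma flip_edge_eq_iff [simp]: "flip_edge n k b = flip_edge m j c \<longleftrightarrow> n = m \<and> k = j \<and> b = c"
  by (simp add: flip_edge_def)

lemma vertices_flip [simp]: "vertices flip_diagram n = range (flip_vertex n)"
  by (simp add: flip_diagram_def)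

lemma edges_flip: "edges flip_diagram n = {flip_edge n k b | k b. True}"
  by (auto simp: flip_diagram_def)

lemma source_flip [simp]: "source flip_diagram (flip_edge n k b) = flip_vertex n (flip_source n k b)"
  by (simp add: flip_diagram_def flip_edge_def)

lemma range_flip [simp]: "range_of flip_diagram (flip_edge n k b) = flip_vertex (Suc n) k"
  by (simp add: flip_diagram_def flip_edge_def)

lemma flip_bit_flip_bit [simp]: "flip_bit n (flip_bit n k) = k" for k :: nat
  by (rule bit_eqI) (auto simp: bit_simps)

lemma flip_bit_commute: "flip_bit n (flip_bit m k) = flip_bit m (flip_bit n k)" for k :: nat
  by (rule bit_eqI) (auto simp: bit_simps)

lemma inj_flip_bit: "inj (\<lambda>n. flip_bit n k)" for k :: nat
proof (rule injI)
  fix m n assume "flip_bit m k = flip_bit n k"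
  then have "bit (flip_bit m k) n = bit (flip_bit n k) n" by simp
  then show "m = n" by (auto simp: bit_simps)
qed

lemma in_edges_flip:
  "{e \<in> edges flip_diagram n. range_of flip_diagram e = flip_vertex (Suc n) k} =
    {flip_edge n k True, flip_edge n k False}"
proof -
  have "b = True \<or> b = False" for b by auto
  then show ?thesis by (auto simp: edges_flip)
qed

lemma out_edges_flip:
  assumes "n \<ge> 1"
  shows "{e \<in> edges flip_diagram n. source flip_diagram e = flip_vertex n k} =
    {flip_edge n k True, flip_edge n (flip_bit n k) False}"
proof -
  have "flip_source n j b = k \<longleftrightarrow> (b \<and> j = k) \<or> (\<not> b \<and> j = flip_bit n k)" for j b
    using assms by (auto simp: flip_source_def)
  then show ?thesis by (auto simp: edges_flip)
qed

interpretation flip: generalized_bratteli_diagram flip_diagram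
proof
  show "disjoint_family (vertices flip_diagram)"
    by (auto simp: disjoint_family_on_def)
  show "disjoint_family (edges flip_diagram)"
    by (auto simp: disjoint_family_on_def edges_flip)
next
  fix n
  show "countable (vertices flip_diagram n)" by simp
  have "inj (flip_vertex n)" by (simp add: inj_def)
  then show "infinite (vertices flip_diagram n)" by (simp add: range_inj_infinite)
next
  fix n e assume "e \<in> edges flip_diagram n"
  then obtain k b where "e = flip_edge n k b" by (auto simp: edges_flip)
  then show "source flip_diagram e \<in> vertices flip_diagram n"
    and "range_of flip_diagram e \<in> vertices flip_diagram (Suc n)" by simp_all
next
  fix n v assume "v \<in> vertices flip_diagram n"
  then obtain k where "v = flip_vertex n k" by auto
  then have "flip_edge n k True \<in> {e \<in> edges flip_diagram n. source flip_diagram e = v}"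
    by (auto simp: edges_flip flip_source_def)
  then show "{e \<in> edges flip_diagram n. source flip_diagram e = v} \<noteq> {}" by blast
next
  fix n v assume "v \<in> vertices flip_diagram (Suc n)"
  then obtain k where "v = flip_vertex (Suc n) k" by auto
  then show "{e \<in> edges flip_diagram n. range_of flip_diagram e = v} \<noteq> {}"
    and "finite {e \<in> edges flip_diagram n. range_of flip_diagram e = v}"
    by (simp_all add: in_edges_flip)
qed

lemma no_isolated_points_flip: "no_isolated_points flip_diagram"
proof (rule flip.no_isolated_pointsI)
  fix n e assume n: "n \<ge> 1" and "e \<in> edges flip_diagram n"
  then obtain k b where e: "e = flip_edge n k b" by (auto simp: edges_flip)
  have "source flip_diagram (flip_edge n (flip_bit n k) (\<not> b)) = source flip_diagram e"
    using n by (auto simp: e flip_source_def)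
  then show "\<exists>e'\<in>edges flip_diagram n. e' \<noteq> e \<and> source flip_diagram e' = source flip_diagram e"
    by (intro bexI[of _ "flip_edge n (flip_bit n k) (\<not> b)"]) (auto simp: e edges_flip)
qed

lemma tail_aperiodic_flip: "tail_aperiodic flip_diagram"
proof (rule flip.tail_aperiodicI)
  fix n e assume "e \<in> edges flip_diagram n"
  then obtain k b where e: "e = flip_edge n k b" by (auto simp: edges_flip)
  show "\<exists>e'\<in>edges flip_diagram n. e' \<noteq> e \<and> range_of flip_diagram e' = range_of flip_diagram e"
    by (rule bexI[of _ "flip_edge n k (\<not> b)"]) (auto simp: e edges_flip)
qed

lemma total_height_flip: "total_height flip_diagram n (flip_vertex n k) = 2 ^ n"
proof (induction n arbitrary: k)
  case 0
  show ?case by (simp add: flip.total_height_0)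
next
  case (Suc n)
  have "total_height flip_diagram (Suc n) (flip_vertex (Suc n) k) =
      (\<Sum>e\<in>{flip_edge n k True, flip_edge n k False}.
        total_height flip_diagram n (source flip_diagram e))"
    using flip.total_height_Suc[of "flip_vertex (Suc n) k" n] unfolding in_edges_flip by simp
  then show ?case by (simp add: Suc.IH)
qed

text \<open>
  Of the two edges into each vertex of level 1 at least one comes from \<open>0\<close>, and from then on the
  proportion of paths starting in \<open>0\<close> is, at each vertex, the mean of its values at the two
  predecessors, so it never drops below one half.
\<close>

lemma height_entry_flip_ge:
  "height_entry flip_diagram (Suc n) (flip_vertex (Suc n) k) (flip_vertex 0 0) \<ge> 2 ^ n"
proof (induction n arbitrary: k)
  case 0
  have "height_entry flip_diagram (Suc 0) (flip_vertex (Suc 0) k) (flip_vertex 0 0) =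
      (\<Sum>e\<in>{flip_edge 0 k True, flip_edge 0 k False}.
        height_entry flip_diagram 0 (source flip_diagram e) (flip_vertex 0 0))"
    using flip.height_entry_Suc[of "flip_vertex (Suc 0) k" 0 "flip_vertex 0 0"]
    unfolding in_edges_flip by (simp del: height_entry.simps)
  then show ?case by (simp add: flip_source_def)
next
  case (Suc n)
  have "height_entry flip_diagram (Suc (Suc n)) (flip_vertex (Suc (Suc n)) k) (flip_vertex 0 0) =
      (\<Sum>e\<in>{flip_edge (Suc n) k True, flip_edge (Suc n) k False}.
        height_entry flip_diagram (Suc n) (source flip_diagram e) (flip_vertex 0 0))"
    using flip.height_entry_Suc[of "flip_vertex (Suc (Suc n)) k" "Suc n" "flip_vertex 0 0"]
    unfolding in_edges_flip by (simp del: height_entry.simps)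
  also have "\<dots> =
      height_entry flip_diagram (Suc n) (flip_vertex (Suc n) (flip_source (Suc n) k True)) (flip_vertex 0 0) +
      height_entry flip_diagram (Suc n) (flip_vertex (Suc n) (flip_source (Suc n) k False)) (flip_vertex 0 0)"
    by (simp del: height_entry.simps)
  also have "\<dots> \<ge> 2 ^ n + 2 ^ n"
    by (intro add_mono Suc.IH)
  finally show ?case by (simp del: height_entry.simps)
qed

lemma liminf_flip_ge_half:
  "liminf (\<lambda>n. SUP v\<in>vertices flip_diagram n.
     ereal (real (height_entry flip_diagram n v (flip_vertex 0 0)) / real (total_height flip_diagram n v)))
   \<ge> ereal (1/2)"
proof (rule Liminf_bounded)
  have "ereal (1/2) \<le> (SUP v\<in>vertices flip_diagram n.
     ereal (real (height_entry flip_diagram n v (flip_vertex 0 0)) / real (total_height flip_diagram n v)))"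
    if n: "n \<ge> 1" for n
  proof -
    from n obtain m where m: "n = Suc m" by (cases n) auto
    have "real (2 ^ m) \<le> real (height_entry flip_diagram n (flip_vertex n 0) (flip_vertex 0 0))"
      unfolding m of_nat_le_iff by (rule height_entry_flip_ge)
    then have "1/2 \<le> real (height_entry flip_diagram n (flip_vertex n 0) (flip_vertex 0 0)) /
        real (total_height flip_diagram n (flip_vertex n 0))"
      by (simp add: total_height_flip m field_simps del: height_entry.simps)
    then show ?thesis by (intro SUP_upper2[of "flip_vertex n 0"]) auto
  qed
  then show "\<forall>\<^sub>F n in sequentially. ereal (1/2) \<le> (SUP v\<in>vertices flip_diagram n.
     ereal (real (height_entry flip_diagram n v (flip_vertex 0 0)) / real (total_height flip_diagram n v)))"
    by (auto simp: eventually_sequentially intro!: exI[of _ 1])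
qed

text \<open>
  At level \<open>n\<close> the vertices \<open>k\<close> and \<open>flip_bit n k\<close> have the same two successors, hence the same weight.
  Flips of different digits commute, so the recursion passes the symmetry down to each lower level
  \<open>m \<ge> 1\<close>; level 0, where the edges do not follow the flip pattern, is excluded.
\<close>

lemma weight_flip_bit:
  assumes p: "invariant_weight flip_diagram p" and "1 \<le> m" "m \<le> n"
  shows "p m (flip_vertex m (flip_bit n k)) = p m (flip_vertex m k)"
proof -
  have rec: "p m (flip_vertex m k) =
      p (Suc m) (flip_vertex (Suc m) k) + p (Suc m) (flip_vertex (Suc m) (flip_bit m k))"
    if "m \<ge> 1" for m k
  proof -
    have "p m (flip_vertex m k) = (\<integral>\<^sup>+e. p (Suc m) (range_of flip_diagram e)
        \<partial>count_space {e \<in> edges flip_diagram m. source flip_diagram e = flip_vertex m k})"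
      using p by (simp add: invariant_weight_def)
    then show ?thesis using that by (simp add: out_edges_flip nn_integral_count_space_finite)
  qed
  show ?thesis using assms(3,2)
  proof (induction m arbitrary: k rule: inc_induct)
    case base
    then show ?case using rec[of n k] rec[of n "flip_bit n k"] by (simp add: add.commute)
  next
    case (step i)
    then show ?case
      using rec[of i k] rec[of i "flip_bit n k"] by (simp add: flip_bit_commute[of i])
  qed
qed

lemma no_tail_invariant_probability_flip: "\<not> admits_tail_invariant_probability flip_diagram"
proof
  assume "admits_tail_invariant_probability flip_diagram"
  then obtain p where p: "invariant_weight flip_diagram p"
    using flip.exists_invariant_weight by blast
  let ?V = "vertices flip_diagram 1"
  have total: "(\<integral>\<^sup>+v. 2 * p 1 v \<partial>count_space ?V) = 1"
  proof -
    have "(\<integral>\<^sup>+v. 2 * p 1 v \<partial>count_space ?V) =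
        (\<integral>\<^sup>+v. of_nat (total_height flip_diagram 1 v) * p 1 v \<partial>count_space ?V)"
      by (rule nn_integral_cong) (auto simp: total_height_flip)
    then show ?thesis using flip.total_weight[OF p, of 1] by simp
  qed
  have "p 1 (flip_vertex 1 k) = 0" for k
  proof (rule ccontr)
    assume neq: "p 1 (flip_vertex 1 k) \<noteq> 0"
    \<comment> \<open>digit 0 is left alone: the symmetry at level 1 concerns the digits from 1 on\<close>
    let ?f = "\<lambda>n. flip_vertex 1 (flip_bit (Suc n) k)"
    have inj: "inj ?f" using inj_flip_bit[of k] by (auto simp: inj_def)
    have "\<infinity> = (\<integral>\<^sup>+v. 2 * p 1 (flip_vertex 1 k) \<partial>count_space (range ?f))"
      using neq range_inj_infinite[OF inj] by (simp add: ennreal_mult_top)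
    also have "\<dots> = (\<integral>\<^sup>+v. 2 * p 1 v \<partial>count_space (range ?f))"
      using weight_flip_bit[OF p] by (intro nn_integral_cong) auto
    also have "\<dots> \<le> (\<integral>\<^sup>+v. 2 * p 1 v \<partial>count_space ?V)"
      by (subst (1 2) nn_integral_count_space_indicator)
        (auto intro!: nn_integral_mono split: split_indicator)
    finally show False using total by (simp add: top_unique)
  qed
  then have "(\<integral>\<^sup>+v. 2 * p 1 v \<partial>count_space ?V) = (\<integral>\<^sup>+v. 0 \<partial>count_space ?V)"
    by (intro nn_integral_cong) auto
  then show False using total by simp
qed

theorem theorem1p1:
  "(\<forall>B :: ('v, 'e) diagram.
      generalized_bratteli_diagram B \<and> no_isolated_points B \<and> tail_aperiodic B \<and>
      (\<forall>w \<in> vertices B 0.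
         liminf (\<lambda>n. SUP v \<in> vertices B n. ereal (real (height_entry B n v w) / real (total_height B n v))) = 0)
      \<longrightarrow> \<not> admits_tail_invariant_probability B) \<and>
   (\<exists>B :: (nat, nat) diagram.
      generalized_bratteli_diagram B \<and> no_isolated_points B \<and> tail_aperiodic B \<and>
      \<not> admits_tail_invariant_probability B \<and>
      (\<exists>w \<in> vertices B 0.
         liminf (\<lambda>n. SUP v \<in> vertices B n. ereal (real (height_entry B n v w) / real (total_height B n v))) \<noteq> 0))"
proof (intro conjI allI impI)
  fix B :: "('v, 'e) diagram"
  assume B: "generalized_bratteli_diagram B \<and> no_isolated_points B \<and> tail_aperiodic B \<and>
      (\<forall>w \<in> vertices B 0.
         liminf (\<lambda>n. SUP v \<in> vertices B n. ereal (real (height_entry B n v w) / real (total_height B n v))) = 0)"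
  then interpret generalized_bratteli_diagram B by blast
  show "\<not> admits_tail_invariant_probability B"
    by (rule no_tail_invariant_probability) (use B in blast)
next
  have "liminf (\<lambda>n. SUP v\<in>vertices flip_diagram n.
     ereal (real (height_entry flip_diagram n v (flip_vertex 0 0)) / real (total_height flip_diagram n v))) \<noteq> 0"
    using liminf_flip_ge_half by auto
  moreover have "flip_vertex 0 0 \<in> vertices flip_diagram 0" by simp
  ultimately show "\<exists>B :: (nat, nat) diagram.
      generalized_bratteli_diagram B \<and> no_isolated_points B \<and> tail_aperiodic B \<and>
      \<not> admits_tail_invariant_probability B \<and>
      (\<exists>w \<in> vertices B 0.
         liminf (\<lambda>n. SUP v \<in> vertices B n. ereal (real (height_entry B n v w) / real (total_height B n v))) \<noteq> 0)"
    using flip.generalized_bratteli_diagram_axioms no_isolated_points_flip tail_aperiodic_flip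
      no_tail_invariant_probability_flip
    by (intro exI[of _ flip_diagram] conjI bexI[of _ "flip_vertex 0 0"])
qed

end
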